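(* For all $m,k\in\mathbb{N}$, $$S^m\genfrac{[}{]}{0pt}{}{x}{k}=\sum_{i=0}^{m}q^{(m-i)(k-i)}\genfrac{[}{]}{0pt}{}{m}{i}_q\genfrac{[}{]}{0pt}{}{x}{k-i},$$ so that the coefficients expressing $S^m\genfrac{[}{]}{0pt}{}{x}{k}$ in the basis of the polynomials $\genfrac{[}{]}{0pt}{}{x}{j}$, $j\in\mathbb{N}$, belong to $\mathbb{N}[q]$.
   Context: Here $q$ and $x$ are commuting indeterminates, $\mathbb{N}=\{0,1,2,\dots\}$. For $n\in\mathbb{N}$, $[n]_q:=(q^n-1)/(q-1)$ and $[n]_q!:=[n]_q\cdots[1]_q$ with $[0]_q!:=1$. For $n,k\in\mathbb{N}$, $\genfrac{[}{]}{0pt}{}{n}{k}_q:=\frac{[n]_q!}{[n-k]_q![k]_q!}$ if $k\le n$ and $0$ if $k>n$. The $q$-binomial coefficient polynomials in $\mathbb{Q}(q)[x]$ are $\genfrac{[}{]}{0pt}{}{x}{k}:=\frac{x(x-[1]_q)\cdots(x-[k-1]_q)}{q^{\binom{k}{2}}[k]_q!}$ for $k\ge1$, $\genfrac{[}{]}{0pt}{}{x}{0}:=1$, and by convention $\genfrac{[}{]}{0pt}{}{x}{k}:=0$ for $k<0$. The shift operator $S\colon\mathbb{Q}(q)[x]\to\mathbb{Q}(q)[x]$ is the $\mathbb{Q}(q)$-linear ring homomorphism with $S(x)=qx+1$. $\mathbb{N}[q]$ denotes polynomials in $q$ with coefficients in $\mathbb{N}$. *)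

theory Defs
  imports "HOL-Computational_Algebra.Computational_Algebra"
begin

text \<open>The field \<open>\<rat>(q)\<close> is \<^typ>\<open>rat poly fract\<close>, and \<open>\<rat>(q)[x]\<close> is \<^typ>\<open>rat poly fract poly\<close>.\<close>

definition q :: "rat poly fract" where
  "q = to_fract [:0, 1:]"

definition qint :: "nat \<Rightarrow> rat poly fract" where
  "qint n = (q ^ n - 1) / (q - 1)"

definition qfact :: "nat \<Rightarrow> rat poly fract" where
  "qfact n = (\<Prod>i\<in>{1..n}. qint i)"

definition qbinom :: "nat \<Rightarrow> nat \<Rightarrow> rat poly fract" where
  "qbinom n k = (if k \<le> n then qfact n / (qfact (n - k) * qfact k) else 0)"

text \<open>
  The lower index is an integer because of the convention for negative indices. The product
  starts with the factor \<open>x - [0]\<^sub>q = x\<close>.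
\<close>
definition qbinom_poly :: "int \<Rightarrow> rat poly fract poly" where
  "qbinom_poly k =
     (if k < 0 then 0
      else smult (1 / (q ^ (nat k choose 2) * qfact (nat k))) (\<Prod>i<nat k. [:0, 1:] - [:qint i:]))"

text \<open>
  The shift operator is substitution of \<open>q x + 1\<close> for \<open>x\<close>; \<open>shift_unique\<close> below identifies it
  with the unique \<open>\<rat>(q)\<close>-linear ring homomorphism sending \<open>x\<close> to \<open>q x + 1\<close>.
\<close>
definition shift :: "rat poly fract poly \<Rightarrow> rat poly fract poly" where
  "shift p = pcompose p [:1, q:]"

definition nat_polys_q :: "rat poly fract set" where
  "nat_polys_q = range (\<lambda>p :: nat poly. to_fract (map_poly of_nat p))"

definition qbinom_basis :: "rat poly fract poly set" where
  "qbinom_basis = range (\<lambda>j :: nat. qbinom_poly (int j))"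

lemma shift_x: "shift [:0, 1:] = smult q [:0, 1:] + 1"
  by (simp add: shift_def pcompose_pCons one_pCons)

lemma shift_1: "shift 1 = 1"
  by (simp add: shift_def pcompose_1)

lemma shift_add: "shift (p + r) = shift p + shift r"
  by (simp add: shift_def pcompose_add)

lemma shift_mult: "shift (p * r) = shift p * shift r"
  by (simp add: shift_def pcompose_mult)

lemma shift_smult: "shift (smult c p) = smult c (shift p)"
  by (simp add: shift_def pcompose_smult)

lemma shift_unique:
  assumes add: "\<And>p r. T (p + r) = T p + T r"
    and mult: "\<And>p r. T (p * r) = T p * T r"
    and one: "T 1 = 1"
    and smult: "\<And>c p. T (smult c p) = smult c (T p)"
    and x: "T [:0, 1:] = smult q [:0, 1:] + 1"
  shows "T = shift"
proof
  fix p
  show "T p = shift p"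
  proof (induction p)
    case 0
    show ?case using smult[of 0 0] by (simp add: shift_def)
  next
    case (pCons a p)
    have "pCons a p = smult a 1 + [:0, 1:] * p" by simp
    then have "T (pCons a p) = smult a 1 + (smult q [:0, 1:] + 1) * T p"
      by (simp only: add mult smult one x)
    also have "\<dots> = shift (pCons a p)"
      by (simp add: pCons.IH shift_def pcompose_pCons one_pCons)
    finally show ?case .
  qed
qed

lemma q_power: "q ^ n = to_fract (monom 1 n)"
proof (induction n)
  case 0
  show ?case by (simp add: monom_0 flip: one_pCons)
next
  case (Suc n)
  have "monom (1 :: rat) (Suc n) = [:0, 1:] * monom 1 n" by (simp add: monom_Suc)
  then show ?case using Suc by (simp only: q_def power_Suc to_fract_mult)
qed

lemma q_nonzero: "q \<noteq> 0"
  by (simp add: q_def)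

lemma q_power_neq_1:
  assumes "n > 0"
  shows "q ^ n \<noteq> 1"
proof
  assume "q ^ n = 1"
  then have "to_fract (monom (1 :: rat) n) = to_fract 1" by (simp add: q_power)
  then have "monom (1 :: rat) n = 1" by (simp only: to_fract_eq_iff)
  then have "degree (monom (1 :: rat) n) = 0" by simp
  then show False using assms by (simp add: degree_monom_eq)
qed

lemma qfact_nonzero: "qfact n \<noteq> 0"
  using q_power_neq_1 q_power_neq_1[of 1] by (auto simp: qfact_def qint_def)

lemma degree_qbinom_poly: "degree (qbinom_poly (int j)) = j"
proof -
  have "degree (\<Prod>i<j. [:0, 1:] - [:qint i:]) = (\<Sum>i<j. degree ([:0, 1:] - [:qint i:]))"
    by (rule degree_prod_eq_sum_degree) simp
  then show ?thesis by (simp add: qbinom_poly_def qfact_nonzero q_nonzero)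
qed

lemma qbinom_poly_nonzero: "qbinom_poly (int j) \<noteq> 0"
  by (auto simp: qbinom_poly_def qfact_nonzero q_nonzero)

lemma inj_qbinom_poly: "inj (\<lambda>j :: nat. qbinom_poly (int j))"
  by (rule injI) (metis degree_qbinom_poly)

lemma vector_space_smult: "vector_space (smult :: 'a :: field \<Rightarrow> 'a poly \<Rightarrow> 'a poly)"
  by unfold_locales (simp_all add: smult_add_left smult_add_right)

lemma module_smult: "module (smult :: 'a :: field \<Rightarrow> 'a poly \<Rightarrow> 'a poly)"
  by unfold_locales (simp_all add: smult_add_left smult_add_right)

lemma qbinom_basis_independent: "\<not> module.dependent smult qbinom_basis"
proof
  assume "module.dependent smult qbinom_basis"
  then obtain t u where t: "finite t" "t \<subseteq> qbinom_basis" "(\<Sum>v\<in>t. smult (u v) v) = 0"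
    and ex: "\<exists>v\<in>t. u v \<noteq> 0"
    by (auto simp: module.dependent_explicit[OF module_smult])
  define A where "A = {v \<in> t. u v \<noteq> 0}"
  have A: "finite A" "A \<noteq> {}" using t ex by (auto simp: A_def)
  define n where "n = Max (degree ` A)"
  have "n \<in> degree ` A" using A by (simp add: n_def)
  then obtain w where w: "w \<in> A" "degree w = n" by auto
  have uniq: "v = w" if "v \<in> qbinom_basis" "degree v = n" for v
    using that w t(2) by (auto simp: A_def qbinom_basis_def degree_qbinom_poly)
  have "coeff (smult (u v) v) n = 0" if "v \<in> t - {w}" for v
  proof (cases "u v = 0")
    case False
    then have "v \<in> A" using that by (simp add: A_def)
    then have "degree v \<le> n" using A by (simp add: n_def)
    moreover have "degree v \<noteq> n" using uniq that t(2) by auto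
    ultimately show ?thesis by (simp add: coeff_eq_0)
  qed simp
  then have "(\<Sum>v\<in>t - {w}. coeff (smult (u v) v) n) = 0"
    by (intro sum.neutral ballI)
  moreover have "w \<in> t" using w(1) by (simp add: A_def)
  ultimately have "(\<Sum>v\<in>t. coeff (smult (u v) v) n) = coeff (smult (u w) w) n"
    using sum.remove[OF t(1), of w "\<lambda>v. coeff (smult (u v) v) n"] by simp
  moreover have "(\<Sum>v\<in>t. coeff (smult (u v) v) n) = 0"
    using arg_cong[OF t(3), of "\<lambda>p. coeff p n"] by (simp only: coeff_sum coeff_0)
  moreover have "w \<noteq> 0" using w(1) t(2) qbinom_poly_nonzero by (auto simp: A_def qbinom_basis_def)
  then have "coeff w n \<noteq> 0" using w(2) by (metis leading_coeff_0_iff)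
  moreover have "u w \<noteq> 0" using w(1) by (simp add: A_def)
  ultimately show False by (simp only: coeff_smult mult_eq_0_iff) blast
qed

lemma qbinom_basis_span: "module.span smult qbinom_basis = UNIV"
proof -
  interpret vector_space "smult :: rat poly fract \<Rightarrow> _" by (rule vector_space_smult)
  have "p \<in> span qbinom_basis" if "p = 0 \<or> degree p < n" for p n
    using that
  proof (induction n arbitrary: p)
    case 0
    then show ?case by (auto simp: span_zero)
  next
    case (Suc n)
    let ?b = "qbinom_poly (int n)"
    let ?c = "coeff p n / coeff ?b n"
    let ?r = "p - smult ?c ?b"
    have b0: "coeff ?b n \<noteq> 0"
      using qbinom_poly_nonzero[of n] degree_qbinom_poly[of n] by (metis leading_coeff_0_iff)
    have "degree p \<le> n" using Suc.prems by auto
    then have "degree ?r \<le> n"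
      by (intro degree_diff_le) (auto simp: degree_qbinom_poly)
    moreover have "?c * coeff ?b n = coeff p n"
      using nonzero_eq_divide_eq[OF b0, of ?c "coeff p n"] by blast
    then have "coeff ?r n = 0"
      by (simp only: coeff_diff coeff_smult diff_self)
    ultimately have "?r = 0 \<or> degree ?r < n"
      by (metis leading_coeff_0_iff le_neq_implies_less)
    then have "?r \<in> span qbinom_basis" by (rule Suc.IH)
    moreover have "smult ?c ?b \<in> span qbinom_basis"
      by (intro span_scale span_base) (auto simp: qbinom_basis_def)
    ultimately have "?r + smult ?c ?b \<in> span qbinom_basis" by (rule span_add)
    then show ?case by (simp only: diff_add_cancel)
  qed
  then show ?thesis by blast
qed

end

theory Submission
  imports Defs
begin

text \<open>
  Everything rests on the case \<open>m = 1\<close>: writing \<open>B\<^sub>k\<close> for the \<open>k\<close>-th \<open>q\<close>-binomial coefficient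
  polynomial, \<open>S B\<^sub>k = q\<^sup>k B\<^sub>k + B\<^sub>k\<^sub>-\<^sub>1\<close>. The reason is that \<open>[i + 1] = q [i] + 1\<close>, so \<open>S\<close> sends the
  factor \<open>x - [i + 1]\<close> to \<open>q (x - [i])\<close>: the product defining \<open>B\<^sub>k\<close> slides down by one factor,
  and only the image \<open>q x + 1\<close> of the factor \<open>x\<close> has to be rewritten in terms of \<open>x - [k - 1]\<close>
  and a constant (\<open>shift_qbinom_poly\<close>).

  Iterating this two-term rule gives a sum over \<open>B\<^sub>k\<^sub>-\<^sub>i\<close> whose coefficients obey, after the power
  of \<open>q\<close> is factored out, the recurrence
  \<open>binom(m + 1, i + 1) = binom(m, i + 1) + q\<^bsup>m - i\<^esup> binom(m, i)\<close> for the \<open>q\<close>-binomial coefficients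
  (\<open>qbinom_Suc_Suc\<close>); this is the expansion \<open>shift_funpow_qbinom_poly\<close>. The same recurrence shows
  by induction that \<open>q\<close>-binomial coefficients lie in \<open>\<nat>[q]\<close>. The exponent \<open>(m - i) (k - i)\<close> can be
  negative only if \<open>i > k\<close>, and then \<open>B\<^sub>k\<^sub>-\<^sub>i = 0\<close>; so all coordinates in the basis lie in \<open>\<nat>[q]\<close>.
\<close>

section \<open>The shift of a single q-binomial coefficient polynomial\<close>

lemma q_neq_1: "q \<noteq> 1"
  using q_power_neq_1[of 1] by simp

lemma qint_0: "qint 0 = 0"
  by (simp add: qint_def)

lemma qint_add: "qint (a + b) = qint a + q ^ a * qint b"
proof -
  have "(q ^ (a + b) - 1) = (q ^ a - 1) + q ^ a * (q ^ b - 1)"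
    by (simp add: power_add algebra_simps)
  then show ?thesis
    unfolding qint_def by (simp only: add_divide_distrib times_divide_eq_right)
qed

lemma qint_Suc: "qint (Suc n) = q * qint n + 1"
  using qint_add[of 1 n] q_neq_1 by (simp add: qint_def)

lemma qint_Suc_nonzero: "qint (Suc n) \<noteq> 0"
  using q_power_neq_1[of "Suc n"] q_neq_1 by (simp add: qint_def)

lemma qfact_0: "qfact 0 = 1"
  by (simp add: qfact_def)

lemma qfact_Suc: "qfact (Suc n) = qint (Suc n) * qfact n"
  by (simp add: qfact_def mult.commute)

text \<open>
  The factor \<open>x\<close> of the product is the one with \<open>i = 0\<close>; splitting it off first lets the other
  factors move down one place each.
\<close>
lemma shift_qprod_Suc:
  "shift (\<Prod>i<Suc n. [:0, 1:] - [:qint i:]) = smult (q ^ n) ([:1, q:] * (\<Prod>i<n. [:0, 1:] - [:qint i:]))"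
proof -
  have shift_prod: "shift (\<Prod>i<n. f i) = (\<Prod>i<n. shift (f i))" for f and n :: nat
    by (induction n) (simp_all add: shift_1 shift_mult)
  have "shift ([:0, 1:] - [:qint (Suc i):]) = smult q ([:0, 1:] - [:qint i:])" for i
    by (simp add: shift_def pcompose_pCons qint_Suc)
  moreover have "(\<Prod>i<n. smult q (f i)) = smult (q ^ n) (\<Prod>i<n. f i)" for f and n :: nat
    by (induction n) (simp_all add: mult_ac)
  moreover have "shift ([:0, 1:] - [:qint 0:]) = [:1, q:]"
    by (simp add: shift_def pcompose_pCons qint_0)
  ultimately show ?thesis
    by (simp only: prod.lessThan_Suc_shift shift_mult shift_prod mult_smult_right)
qed

lemma choose_2_Suc: "Suc n choose 2 = n + (n choose 2)"
  by (simp add: numeral_2_eq_2)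

text \<open>
  Stated for integer \<open>k\<close> so that it also covers \<open>k = 0\<close>, where the second summand vanishes, and
  \<open>k < 0\<close>, where both sides do; the induction on the number of shifts then needs no case
  distinction. For \<open>k = n + 1\<close> the identity is \<open>q (x - [n]) + [n + 1] = q x + 1\<close>, scaled by \<open>q\<^sup>n\<close>.
\<close>
lemma shift_qbinom_poly:
  "shift (qbinom_poly k) = smult (q powi k) (qbinom_poly k) + qbinom_poly (k - 1)"
proof -
  consider "k < 0" | "k = 0" | n where "k = int (Suc n)"
    using that(3)[of "nat (k - 1)"] by linarith
  then show ?thesis
  proof cases
    case 1
    then show ?thesis by (simp add: qbinom_poly_def shift_def)
  next
    case 2
    then show ?thesis
      by (simp add: qbinom_poly_def shift_def qfact_0 pcompose_pCons)
  next
    case 3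
    define P where "P = (\<Prod>i<n. [:0, 1:] - [:qint i:])"
    define c where "c = 1 / (q ^ (Suc n choose 2) * qfact (Suc n))"
    have Bk: "qbinom_poly k = smult c (P * ([:0, 1:] - [:qint n:]))"
      by (simp only: 3 qbinom_poly_def c_def P_def nat_int prod.lessThan_Suc) simp
    have "c * (q ^ n * qint (Suc n)) = 1 / (q ^ (n choose 2) * qfact n)"
      using q_nonzero qint_Suc_nonzero[of n] qfact_nonzero[of n]
      by (simp add: c_def choose_2_Suc qfact_Suc power_add)
    moreover have "k - 1 = int n" using 3 by simp
    ultimately have Bk': "qbinom_poly (k - 1) = smult (c * (q ^ n * qint (Suc n))) P"
      by (simp add: qbinom_poly_def P_def)
    have "shift (qbinom_poly k) = smult c (smult (q ^ n) ([:1, q:] * P))"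
      using shift_qprod_Suc[of n]
      by (simp only: Bk shift_smult P_def prod.lessThan_Suc)
    also have "[:1, q:] = smult q ([:0, 1:] - [:qint n:]) + [:qint (Suc n):]"
      by (simp add: qint_Suc)
    also have "smult c (smult (q ^ n) (\<dots> * P))
        = smult (q ^ Suc n) (smult c (P * ([:0, 1:] - [:qint n:])))
          + smult (c * (q ^ n * qint (Suc n))) P"
      by (simp add: algebra_simps smult_add_right smult_diff_right smult_diff_left)
    finally show ?thesis
      unfolding Bk Bk' by (simp only: 3 power_int_of_nat)
  qed
qed

section \<open>The q-Pascal recurrence and the iterated shift\<close>

lemma qbinom_0: "qbinom n 0 = 1"
  using qfact_nonzero by (simp add: qbinom_def qfact_0)

lemma qbinom_eq_0: "n < k \<Longrightarrow> qbinom n k = 0"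
  by (simp add: qbinom_def)

text \<open>
  Over the common denominator this is \<open>[n + 1] = [n - k] + q\<^bsup>n - k\<^esup> [k + 1]\<close>. For \<open>k > n\<close> the
  truncated exponent is harmless since both binomial coefficients vanish.
\<close>
lemma qbinom_Suc_Suc:
  "qbinom (Suc n) (Suc k) = qbinom n (Suc k) + q ^ (n - k) * qbinom n k"
proof -
  consider "n < k" | "n = k" | d where "n = k + Suc d"
    by (metis less_iff_Suc_add add_Suc_right linorder_neqE_nat)
  then show ?thesis
  proof cases
    case 3
    have "qint (Suc n) = qint (Suc d) + q ^ Suc d * qint (Suc k)"
      using qint_add[of "Suc d" "Suc k"] 3 by (simp add: add_ac)
    then show ?thesis
      using qint_Suc_nonzero[of d] qint_Suc_nonzero[of k] qfact_nonzero[of d] qfact_nonzero[of k] 3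
      by (simp add: qbinom_def qfact_Suc[of "Suc (d + k)"] qfact_Suc[of d] qfact_Suc[of k] field_simps
               del: power_Suc)
  qed (use qfact_nonzero in \<open>simp_all add: qbinom_def qfact_0\<close>)
qed

theorem shift_funpow_qbinom_poly:
  fixes k :: int
  shows "(shift ^^ m) (qbinom_poly k) =
           (\<Sum>i=0..m. smult (q powi ((int m - int i) * (k - int i)) * qbinom m i)
                        (qbinom_poly (k - int i)))"
proof (induction m)
  case 0
  show ?case by (simp add: qbinom_0)
next
  case (Suc m)
  define c where "c i = q powi ((int m - int i) * (k - int i)) * qbinom m i" for i
  define B where "B i = qbinom_poly (k - int i)" for i
  define u where "u i = q powi ((int (Suc m) - int i) * (k - int i))" for i
  have shift_sum: "shift (sum f A) = (\<Sum>i\<in>A. shift (f i))" if "finite A" for f and A :: "nat set"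
    using that by (induction A) (simp_all add: shift_add, simp add: shift_def)
  have shift_B: "shift (B i) = smult (q powi (k - int i)) (B i) + B (Suc i)" for i
    using shift_qbinom_poly[of "k - int i"] by (simp add: B_def algebra_simps)
  have keep: "c i * q powi (k - int i) = u i * qbinom m i" for i
    using q_nonzero by (simp add: c_def u_def algebra_simps flip: power_int_add)
  have lower: "c i = u (Suc i) * (q ^ (m - i) * qbinom m i)" if "i \<le> m" for i
  proof -
    have "q ^ (m - i) = q powi (int m - int i)"
      using that by (simp flip: power_int_of_nat)
    then show ?thesis
      using q_nonzero by (simp add: c_def u_def algebra_simps flip: power_int_add)
  qed
  have "(shift ^^ Suc m) (qbinom_poly k) = (\<Sum>i=0..m. smult (c i) (shift (B i)))"
    by (simp add: Suc shift_sum shift_smult c_def B_def)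
  also have "\<dots> = (\<Sum>i=0..m. smult (u i * qbinom m i) (B i)) + (\<Sum>i=0..m. smult (c i) (B (Suc i)))"
    by (simp add: shift_B smult_add_right sum.distrib keep)
  \<comment> \<open>The additional term vanishes because \<open>qbinom m (Suc m) = 0\<close>.\<close>
  also have "(\<Sum>i=0..m. smult (u i * qbinom m i) (B i))
      = (\<Sum>i=0..Suc m. smult (u i * qbinom m i) (B i))"
    by (simp add: qbinom_eq_0)
  also have "\<dots> = smult (u 0) (B 0) + (\<Sum>i=0..m. smult (u (Suc i) * qbinom m (Suc i)) (B (Suc i)))"
    by (subst sum.atLeast0_atMost_Suc_shift) (simp add: qbinom_0)
  also have "\<dots> + (\<Sum>i=0..m. smult (c i) (B (Suc i)))
      = smult (u 0) (B 0) + (\<Sum>i=0..m. smult (u (Suc i) * qbinom (Suc m) (Suc i)) (B (Suc i)))"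
    by (simp add: lower qbinom_Suc_Suc distrib_left smult_add_left sum.distrib add.assoc)
  also have "\<dots> = (\<Sum>i=0..Suc m. smult (u i * qbinom (Suc m) i) (B i))"
    by (subst sum.atLeast0_atMost_Suc_shift) (simp add: qbinom_0)
  finally show ?case by (simp only: u_def B_def)
qed

section \<open>Coefficients in N[q]\<close>

lemma nat_polys_q_of_nat: "to_fract (map_poly of_nat p) \<in> nat_polys_q"
  by (auto simp: nat_polys_q_def)

lemma nat_polys_q_0: "0 \<in> nat_polys_q"
  using nat_polys_q_of_nat[of 0] by simp

lemma nat_polys_q_1: "1 \<in> nat_polys_q"
  using nat_polys_q_of_nat[of 1] by simp

lemma nat_polys_q_q: "q \<in> nat_polys_q"
  using nat_polys_q_of_nat[of "[:0, 1:]"] by (simp add: q_def map_poly_pCons)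

lemma nat_polys_q_add: "a \<in> nat_polys_q \<Longrightarrow> b \<in> nat_polys_q \<Longrightarrow> a + b \<in> nat_polys_q"
proof -
  have "map_poly of_nat (p + r) = (map_poly of_nat p + map_poly of_nat r :: rat poly)" for p r
    by (rule poly_eqI) (simp add: coeff_map_poly)
  then show "a \<in> nat_polys_q \<Longrightarrow> b \<in> nat_polys_q \<Longrightarrow> a + b \<in> nat_polys_q"
    unfolding nat_polys_q_def by (clarsimp simp: image_iff) (metis to_fract_add)
qed

lemma nat_polys_q_mult: "a \<in> nat_polys_q \<Longrightarrow> b \<in> nat_polys_q \<Longrightarrow> a * b \<in> nat_polys_q"
proof -
  have "map_poly of_nat (p * r) = (map_poly of_nat p * map_poly of_nat r :: rat poly)" for p r
    by (rule poly_eqI) (simp add: coeff_map_poly coeff_mult)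
  then show "a \<in> nat_polys_q \<Longrightarrow> b \<in> nat_polys_q \<Longrightarrow> a * b \<in> nat_polys_q"
    unfolding nat_polys_q_def by (clarsimp simp: image_iff) (metis to_fract_mult)
qed

lemma nat_polys_q_power: "a \<in> nat_polys_q \<Longrightarrow> a ^ n \<in> nat_polys_q"
  by (induction n) (simp_all add: nat_polys_q_1 nat_polys_q_mult)

lemma nat_polys_q_sum: "(\<And>i. i \<in> A \<Longrightarrow> f i \<in> nat_polys_q) \<Longrightarrow> sum f A \<in> nat_polys_q"
  by (induction A rule: infinite_finite_induct) (simp_all add: nat_polys_q_0 nat_polys_q_add)

lemma qbinom_in_nat_polys_q: "qbinom n k \<in> nat_polys_q"
proof (induction n arbitrary: k)
  case 0
  show ?case
    by (cases k) (simp_all add: qbinom_0 qbinom_eq_0 nat_polys_q_0 nat_polys_q_1)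
next
  case (Suc n)
  then show ?case
    by (cases k) (simp_all add: qbinom_0 qbinom_Suc_Suc nat_polys_q_1 nat_polys_q_add
        nat_polys_q_mult nat_polys_q_power nat_polys_q_q)
qed

theorem mainTheorem5:
  fixes m k :: nat
  shows "(shift ^^ m) (qbinom_poly (int k)) =
           (\<Sum>i=0..m. smult (q powi ((int m - int i) * (int k - int i)) * qbinom m i)
                        (qbinom_poly (int k - int i)))
         \<and> (\<forall>j :: nat. module.representation smult qbinom_basis
              ((shift ^^ m) (qbinom_poly (int k))) (qbinom_poly (int j)) \<in> nat_polys_q)"
proof (intro conjI allI)
  show expansion: "(shift ^^ m) (qbinom_poly (int k)) =
           (\<Sum>i=0..m. smult (q powi ((int m - int i) * (int k - int i)) * qbinom m i)
                        (qbinom_poly (int k - int i)))"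
    by (rule shift_funpow_qbinom_poly)
  fix j :: nat
  interpret vector_space "smult :: rat poly fract \<Rightarrow> _" by (rule vector_space_smult)
  let ?rep = "\<lambda>p. representation qbinom_basis p (qbinom_poly (int j))"
  let ?c = "\<lambda>i. q powi ((int m - int i) * (int k - int i)) * qbinom m i"
  note indep = qbinom_basis_independent
  have in_span: "p \<in> span qbinom_basis" for p
    by (simp add: qbinom_basis_span)
  have "?rep ((shift ^^ m) (qbinom_poly (int k)))
      = (\<Sum>i=0..m. ?c i * ?rep (qbinom_poly (int k - int i)))"
    by (simp only: expansion representation_sum[OF indep in_span] representation_scale[OF indep in_span])
  also have "\<dots> \<in> nat_polys_q"
  proof (rule nat_polys_q_sum)
    fix i assume i: "i \<in> {0..m}"
    show "?c i * ?rep (qbinom_poly (int k - int i)) \<in> nat_polys_q"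
    proof (cases "i \<le> k")
      case True
      have "(int m - int i) * (int k - int i) = int ((m - i) * (k - i))"
        using True i by simp
      then have "?c i \<in> nat_polys_q"
        by (simp only: power_int_of_nat)
          (intro nat_polys_q_mult nat_polys_q_power nat_polys_q_q qbinom_in_nat_polys_q)
      moreover have "qbinom_poly (int k - int i) \<in> qbinom_basis"
        using True unfolding qbinom_basis_def by (metis of_nat_diff rangeI)
      then have "?rep (qbinom_poly (int k - int i)) \<in> nat_polys_q"
        by (simp add: representation_basis[OF indep] nat_polys_q_0 nat_polys_q_1)
      ultimately show ?thesis by (rule nat_polys_q_mult)
    next
      case False
      then have "qbinom_poly (int k - int i) = 0"
        by (simp add: qbinom_poly_def)
      then show ?thesis by (simp add: representation_zero nat_polys_q_0)
    qed
  qed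
  finally show "?rep ((shift ^^ m) (qbinom_poly (int k))) \<in> nat_polys_q" .
qed

end
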